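(* Let $p,q$ be distinct odd primes such that $p\not\equiv \pm 1 \pmod q$. Then there exists an exceptional clique of size $(p-1)^2$ in $\mathrm{Mat}_{(q-1)(p-1)/4}(\mathbb{Z})$.
   Context: $\mathrm{Mat}_n(\mathbb{Z})$ is the ring of $n\times n$ integer matrices. An exceptional clique in a unital ring $R$ is a subset $C\subseteq R$ such that $u-v$ is a unit of $R$ for all distinct $u,v\in C$. *)

theory Defs
  imports
    "HOL-Number_Theory.Cong"
    "HOL-Computational_Algebra.Primes"
    "Jordan_Normal_Form.Matrix"
begin

definition exceptional_clique :: "('a, 'b) ring_scheme \<Rightarrow> 'a set \<Rightarrow> bool" where
  "exceptional_clique R C \<longleftrightarrow>
     C \<subseteq> carrier R \<and> (\<forall>u\<in>C. \<forall>v\<in>C. u \<noteq> v \<longrightarrow> u \<ominus>\<^bsub>R\<^esub> v \<in> Units R)"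

abbreviation Mat_int :: "nat \<Rightarrow> int mat ring" where
  "Mat_int n \<equiv> ring_mat TYPE(int) n ()"

lemma Mat_int_minus:
  assumes "A \<in> carrier_mat n n" "B \<in> carrier_mat n n"
  shows "A \<ominus>\<^bsub>Mat_int n\<^esub> B = A - B"
proof -
  interpret ring "Mat_int n" by (rule ring_mat)
  have "\<ominus>\<^bsub>Mat_int n\<^esub> B = - B"
    by (rule minus_equality) (use assms in \<open>auto simp: ring_mat_simps\<close>)
  then show ?thesis
    using assms by (auto simp: a_minus_def ring_mat_simps)
qed

lemma Units_Mat_int:
  "Units (Mat_int n) =
     {A \<in> carrier_mat n n. \<exists>B\<in>carrier_mat n n. B * A = 1\<^sub>m n \<and> A * B = 1\<^sub>m n}"
  by (auto simp: Units_def ring_mat_simps)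

end

theory Submission
  imports Defs "Jordan_Normal_Form.Determinant" Complex_Main "HOL-Number_Theory.Number_Theory"
    "HOL-Computational_Algebra.Fundamental_Theorem_Algebra"
begin

text \<open>Let \<open>L\<close> be the free abelian group of rank \<open>(p - 1) (q - 1) / 4\<close> spanned by the functions
  \<open>sin (2\<pi>ia/p) sin (2\<pi>jb/q)\<close> of integers \<open>a, b\<close>, and let \<open>\<sigma>\<close> be the substitution
  \<open>a \<mapsto> g a\<close> for a primitive root \<open>g\<close> modulo \<open>p\<close>. The cyclotomic units
  \<open>u\<^sub>i = sin (2\<pi>(i+1)a/p) / sin (2\<pi>ia/p)\<close> with \<open>1 \<le> i < p\<close> multiply \<open>L\<close> into itself, and their
  differences are units of norm 1. With \<open>\<tau> = 2 cos (2\<pi>a/p) - 2 cos (4\<pi>b/q)\<close> the clique consists of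
  the operators \<open>u\<^sub>i + u\<^sub>j \<tau> \<sigma>\<close> on \<open>L\<close>. A difference of two of them is \<open>\<alpha> + \<beta> \<tau> \<sigma>\<close>, where each of
  \<open>\<alpha>, \<beta>\<close> is zero or a unit of norm 1 and not both vanish. As \<open>\<sigma>\<close> has order dividing \<open>p - 1\<close>, a
  geometric series inverts it as soon as \<open>N(\<tau>)\<close> and \<open>1 - N(\<tau>)\<close> are units. Here \<open>N(\<tau>) = t\<^sup>2\<close> with
  \<open>t = sin (2\<pi>pb/q) / sin (2\<pi>b/q)\<close>, a unit since \<open>p \<noteq> q\<close>, and
  \<open>1 - t\<^sup>2 = sin (2\<pi>(1-p)b/q) sin (2\<pi>(1+p)b/q) / sin\<^sup>2 (2\<pi>b/q)\<close> is a unit because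
  \<open>p\<close> is not congruent to \<open>1\<close> or \<open>-1\<close> modulo \<open>q\<close>.\<close>

section \<open>From operators on a free abelian group to integer matrices\<close>

definition int_span :: "nat \<Rightarrow> (nat \<Rightarrow> 'x \<Rightarrow> real) \<Rightarrow> ('x \<Rightarrow> real) set" where
  "int_span n e = {f. \<exists>c::nat \<Rightarrow> int. f = (\<lambda>x. \<Sum>i<n. of_int (c i) * e i x)}"

text \<open>Over the rationals a one-sided inverse of a square matrix is two-sided, and the
  embedding of the integers is injective.\<close>

lemma int_mat_left_right_inverse:
  fixes A B :: "int mat"
  assumes A: "A \<in> carrier_mat n n" and B: "B \<in> carrier_mat n n" and AB: "A * B = 1\<^sub>m n"
  shows "B * A = 1\<^sub>m n"
proof -
  let ?h = "map_mat (of_int :: int \<Rightarrow> rat)"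
  have "?h A * ?h B = 1\<^sub>m n"
    using AB of_int_hom.mat_hom_mult[OF A B] of_int_hom.mat_hom_one by metis
  then have "?h B * ?h A = 1\<^sub>m n"
    using A B by (intro mat_mult_left_right_inverse[of "?h A" n]) auto
  then have "?h (B * A) = ?h (1\<^sub>m n)"
    using of_int_hom.mat_hom_mult[OF B A] of_int_hom.mat_hom_one by metis
  then show ?thesis by (rule of_int_hom.mat_hom_inj)
qed

text \<open>Each operator is replaced by its matrix in the basis \<open>e\<close>. Independence
  makes coordinates unique, so preimages of the basis elements under a difference of operators give
  a right inverse of the difference of matrices. As \<open>n > 0\<close>, the zero matrix is no
  unit, so distinct indices give distinct matrices.\<close>

lemma exceptional_clique_of_operators:
  fixes e :: "nat \<Rightarrow> 'x \<Rightarrow> real" and T :: "'j \<Rightarrow> ('x \<Rightarrow> real) \<Rightarrow> 'x \<Rightarrow> real"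
  assumes n: "n > 0" and fin: "finite J"
    and indep: "\<And>c::nat \<Rightarrow> int. (\<And>x. (\<Sum>i<n. of_int (c i) * e i x) = 0) \<Longrightarrow> \<forall>i<n. c i = 0"
    and lin: "\<And>j (c::nat \<Rightarrow> int).
      T j (\<lambda>x. \<Sum>i<n. of_int (c i) * e i x) = (\<lambda>x. \<Sum>i<n. of_int (c i) * T j (e i) x)"
    and closed: "\<And>j i. j \<in> J \<Longrightarrow> i < n \<Longrightarrow> T j (e i) \<in> int_span n e"
    and surj: "\<And>j j' i. j \<in> J \<Longrightarrow> j' \<in> J \<Longrightarrow> j \<noteq> j' \<Longrightarrow> i < n \<Longrightarrow>
      \<exists>f\<in>int_span n e. \<forall>x. T j f x - T j' f x = e i x"
  shows "\<exists>C. exceptional_clique (Mat_int n) C \<and> finite C \<and> card C = card J"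
proof -
  have "\<exists>c::nat \<Rightarrow> int. j \<in> J \<and> l < n \<longrightarrow> T j (e l) = (\<lambda>x. \<Sum>i<n. of_int (c i) * e i x)" for j l
    using closed unfolding int_span_def by blast
  then obtain a :: "'j \<Rightarrow> nat \<Rightarrow> nat \<Rightarrow> int" where
    a: "\<And>j l. j \<in> J \<Longrightarrow> l < n \<Longrightarrow> T j (e l) = (\<lambda>x. \<Sum>i<n. of_int (a j l i) * e i x)"
    by metis
  define M where "M j = mat n n (\<lambda>(i, l). a j l i)" for j
  have M: "M j \<in> carrier_mat n n" for j by (simp add: M_def)
  have unit: "M j - M j' \<in> Units (Mat_int n)" if j: "j \<in> J" "j' \<in> J" "j \<noteq> j'" for j j'
  proof -
    have "\<forall>r. \<exists>c::nat \<Rightarrow> int. r < n \<longrightarrow> (\<forall>x. T j (\<lambda>x. \<Sum>i<n. of_int (c i) * e i x) x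
        - T j' (\<lambda>x. \<Sum>i<n. of_int (c i) * e i x) x = e r x)"
    proof
      fix r
      show "\<exists>c::nat \<Rightarrow> int. r < n \<longrightarrow> (\<forall>x. T j (\<lambda>x. \<Sum>i<n. of_int (c i) * e i x) x
        - T j' (\<lambda>x. \<Sum>i<n. of_int (c i) * e i x) x = e r x)"
        using surj[OF j, of r] unfolding int_span_def by blast
    qed
    from choice[OF this] obtain b :: "nat \<Rightarrow> nat \<Rightarrow> int" where
      b: "\<And>r x. r < n \<Longrightarrow> T j (\<lambda>x. \<Sum>i<n. of_int (b r i) * e i x) x
        - T j' (\<lambda>x. \<Sum>i<n. of_int (b r i) * e i x) x = e r x"
      by blast
    have key: "(\<Sum>l<n. (a j l i - a j' l i) * b r l) = (if i = r then 1 else 0)"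
      if r: "r < n" and i: "i < n" for r i
    proof -
      \<comment> \<open>Coordinates of the image of the chosen preimage, minus those of
        \<open>e r\<close>; independence forces them to be zero.\<close>
      define c where "c i = (\<Sum>l<n. (a j l i - a j' l i) * b r l) - (if i = r then 1 else 0)" for i
      have "(\<Sum>i<n. of_int (c i) * e i x) = 0" for x
      proof -
        have "e r x = (\<Sum>l<n. of_int (b r l) * T j (e l) x) - (\<Sum>l<n. of_int (b r l) * T j' (e l) x)"
          using b[OF r, of x] by (simp add: lin)
        also have "\<dots> = (\<Sum>l<n. \<Sum>i<n. of_int ((a j l i - a j' l i) * b r l) * e i x)"
          using j by (simp add: a sum_distrib_left algebra_simps sum_subtractf)
        also have "\<dots> = (\<Sum>i<n. of_int (\<Sum>l<n. (a j l i - a j' l i) * b r l) * e i x)"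
          by (subst sum.swap) (simp add: sum_distrib_right)
        finally have 1: "e r x = (\<Sum>i<n. of_int (\<Sum>l<n. (a j l i - a j' l i) * b r l) * e i x)" .
        have 2: "(\<Sum>i<n. (if i = r then 1 else 0) * e i x) = e r x"
          using r by (simp add: if_distrib[of "\<lambda>z. z * _"] cong: if_cong)
        have "(\<Sum>i<n. of_int (c i) * e i x)
            = (\<Sum>i<n. of_int (\<Sum>l<n. (a j l i - a j' l i) * b r l) * e i x)
              - (\<Sum>i<n. (if i = r then 1 else 0) * e i x)"
          unfolding sum_subtractf[symmetric]
          by (intro sum.cong refl) (simp add: c_def algebra_simps)
        then show ?thesis using 1 2 by simp
      qed
      then have "c i = 0" using indep i by blast
      then show ?thesis by (simp add: c_def)
    qed
    \<comment> \<open>Column \<open>r\<close> holds the coordinates of a preimage of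
      \<open>e r\<close>.\<close>
    define B where "B = mat n n (\<lambda>(l, r). b r l)"
    have B: "B \<in> carrier_mat n n" by (simp add: B_def)
    have D: "M j - M j' \<in> carrier_mat n n" by (intro minus_carrier_mat M)
    have "(M j - M j') * B = 1\<^sub>m n"
      by (rule eq_matI) (auto simp: M_def B_def scalar_prod_def key lessThan_atLeast0[symmetric])
    with int_mat_left_right_inverse[OF D B] show ?thesis
      using B D by (auto simp: Units_Mat_int)
  qed
  have "inj_on M J"
  proof (rule inj_onI, rule ccontr)
    fix j j' assume j: "j \<in> J" "j' \<in> J" "M j = M j'" "j \<noteq> j'"
    then have "0\<^sub>m n n \<in> Units (Mat_int n)"
      using unit[of j j'] M[of j] minus_r_inv_mat[of "M j'" n n] by (simp add: M)
    then obtain B :: "int mat" where B: "B \<in> carrier_mat n n" "B * 0\<^sub>m n n = 1\<^sub>m n"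
      unfolding Units_Mat_int by auto
    then have "(0\<^sub>m n n :: int mat) = 1\<^sub>m n" by (metis right_mult_zero_mat)
    then have "(0\<^sub>m n n :: int mat) $$ (0, 0) = 1\<^sub>m n $$ (0, 0)" by (rule arg_cong)
    then show False using n by simp
  qed
  then have "card (M ` J) = card J" by (rule card_image)
  moreover have "exceptional_clique (Mat_int n) (M ` J)"
    unfolding exceptional_clique_def
    using M unit by (auto simp: Mat_int_minus ring_mat_simps)
  ultimately show ?thesis using fin by blast
qed

section \<open>Sines and cosines as functions of a residue\<close>

definition sn :: "nat \<Rightarrow> int \<Rightarrow> real" where
  "sn n x = sin (2 * pi * of_int x / of_nat n)"

definition cs :: "nat \<Rightarrow> int \<Rightarrow> real" where
  "cs n x = cos (2 * pi * of_int x / of_nat n)"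

lemma sn_cs_cong:
  assumes "[x = y] (mod int n)"
  shows "sn n x = sn n y" and "cs n x = cs n y"
proof -
  obtain k where k: "x = y + int n * k"
    using assms by (metis cong_iff_lin cong_sym)
  have "sn n x = sn n y \<and> cs n x = cs n y"
  proof (cases "n = 0")
    case False
    then have *: "2 * pi * of_int x / of_nat n = 2 * pi * of_int y / of_nat n + 2 * pi * of_int k"
      by (simp add: k field_simps)
    show ?thesis
      unfolding sn_def cs_def * sin_add cos_add by simp
  qed (simp add: k)
  then show "sn n x = sn n y" "cs n x = cs n y" by auto
qed

lemma sn_0 [simp]: "sn n 0 = 0"
  by (simp add: sn_def)

lemma sn_minus [simp]: "sn n (- x) = - sn n x"
  by (simp add: sn_def)

lemma sn_times_cs: "2 * cs n y * sn n x = sn n (x + y) + sn n (x - y)"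
  by (simp add: sn_def cs_def ring_distribs add_divide_distrib diff_divide_distrib sin_add sin_diff)

lemma sn_times_sn: "2 * sn n x * sn n y = cs n (x - y) - cs n (x + y)"
  by (simp add: sn_def cs_def ring_distribs add_divide_distrib diff_divide_distrib cos_add cos_diff)

text \<open>The sine vanishes exactly when \<open>n\<close> divides \<open>2 * x\<close>, and the 2
  cancels because \<open>n\<close> is odd.\<close>

lemma sn_eq_0_iff:
  assumes "odd n"
  shows "sn n x = 0 \<longleftrightarrow> int n dvd x"
proof -
  have n: "n > 0" using assms by (rule odd_pos)
  have "sn n x = 0 \<longleftrightarrow> (\<exists>i::int. 2 * pi * of_int x / of_nat n = of_int i * pi)"
    unfolding sn_def by (rule sin_zero_iff_int2)
  also have "\<dots> \<longleftrightarrow> (\<exists>i::int. 2 * x = i * int n)"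
  proof (intro arg_cong[where f = Ex] ext)
    fix i :: int
    have "2 * pi * of_int x / of_nat n = of_int i * pi
        \<longleftrightarrow> real_of_int (2 * x) = real_of_int (i * int n)"
      using n by (simp add: field_simps)
    then show "2 * pi * of_int x / of_nat n = of_int i * pi \<longleftrightarrow> 2 * x = i * int n"
      by (simp only: of_int_eq_iff)
  qed
  also have "\<dots> \<longleftrightarrow> int n dvd 2 * x"
    by (auto simp: dvd_def mult.commute)
  also have "\<dots> \<longleftrightarrow> int n dvd x"
    using assms by (intro coprime_dvd_mult_right_iff) simp
  finally show ?thesis .
qed

section \<open>The lattice of sine products and its multipliers\<close>

text \<open>A function of \<open>(a, b)\<close>, with \<open>a\<close> and \<open>b\<close> read modulo \<open>p\<close> and \<open>q\<close>, lists all Galois conjugates of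
  an algebraic number at once.\<close>

inductive_set sine_lattice :: "nat \<Rightarrow> nat \<Rightarrow> (int \<times> int \<Rightarrow> real) set" for p q where
  zero: "(\<lambda>x. 0) \<in> sine_lattice p q"
| plus: "f \<in> sine_lattice p q \<Longrightarrow>
    (\<lambda>x. f x + sn p (i * fst x) * sn q (j * snd x)) \<in> sine_lattice p q"
| minus: "f \<in> sine_lattice p q \<Longrightarrow>
    (\<lambda>x. f x - sn p (i * fst x) * sn q (j * snd x)) \<in> sine_lattice p q"

lemma sine_lattice_basic: "(\<lambda>x. sn p (i * fst x) * sn q (j * snd x)) \<in> sine_lattice p q"
  using sine_lattice.plus[OF sine_lattice.zero, where i = i and j = j] by simp

lemma sine_lattice_add:
  assumes "f \<in> sine_lattice p q" "h \<in> sine_lattice p q"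
  shows "(\<lambda>x. f x + h x) \<in> sine_lattice p q"
  using assms(2)
proof induction
  case (plus h i j)
  from sine_lattice.plus[OF plus.IH, where i = i and j = j] show ?case by (simp add: add.assoc)
next
  case (minus h i j)
  from sine_lattice.minus[OF minus.IH, where i = i and j = j] show ?case by (simp add: algebra_simps)
qed (simp add: assms(1))

lemma sine_lattice_uminus:
  assumes "f \<in> sine_lattice p q"
  shows "(\<lambda>x. - f x) \<in> sine_lattice p q"
  using assms
proof induction
  case (plus h i j)
  from sine_lattice.minus[OF plus.IH, where i = i and j = j] show ?case by (simp add: algebra_simps)
next
  case (minus h i j)
  from sine_lattice.plus[OF minus.IH, where i = i and j = j] show ?case by (simp add: algebra_simps)
qed (simp add: sine_lattice.zero)

lemma sine_lattice_diff:
  assumes "f \<in> sine_lattice p q" "h \<in> sine_lattice p q"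
  shows "(\<lambda>x. f x - h x) \<in> sine_lattice p q"
  using sine_lattice_add[OF assms(1) sine_lattice_uminus[OF assms(2)]] by simp

lemma sine_lattice_sum:
  assumes "\<And>i. i \<in> I \<Longrightarrow> f i \<in> sine_lattice p q"
  shows "(\<lambda>x. \<Sum>i\<in>I. f i x) \<in> sine_lattice p q"
  using assms by (induction I rule: infinite_finite_induct)
    (auto intro: sine_lattice.zero sine_lattice_add)

text \<open>Exchanging the primes transfers multipliers in the first coordinate to the second; see
  \<open>sine_mult_swap\<close>.\<close>

lemma sine_lattice_swap:
  "f \<in> sine_lattice p q \<Longrightarrow> (\<lambda>x. f (prod.swap x)) \<in> sine_lattice q p"
proof (induction rule: sine_lattice.induct)
  case (plus h i j)
  from sine_lattice.plus[OF plus.IH, where i = j and j = i] show ?case by (simp add: mult.commute)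
next
  case (minus h i j)
  from sine_lattice.minus[OF minus.IH, where i = j and j = i] show ?case by (simp add: mult.commute)
qed (rule sine_lattice.zero)

lemma sine_lattice_shift:
  "f \<in> sine_lattice p q \<Longrightarrow> (\<lambda>x. f (g * fst x, snd x)) \<in> sine_lattice p q"
proof (induction rule: sine_lattice.induct)
  case (plus h i j)
  from sine_lattice.plus[OF plus.IH, where i = "i * g" and j = j] show ?case by (simp add: mult.assoc)
next
  case (minus h i j)
  from sine_lattice.minus[OF minus.IH, where i = "i * g" and j = j] show ?case by (simp add: mult.assoc)
qed (rule sine_lattice.zero)

text \<open>Hence a shift by a power of \<open>g\<close> that is 1 modulo \<open>p\<close> acts
  trivially on the lattice.\<close>

lemma sine_lattice_periodic:
  assumes "f \<in> sine_lattice p q" "[a = a'] (mod int p)"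
  shows "f (a, b) = f (a', b)"
proof -
  have *: "sn p (i * a) = sn p (i * a')" for i
    by (intro sn_cs_cong cong_mult cong_refl assms(2))
  show ?thesis using assms(1) by induction (auto simp: *)
qed

text \<open>For primes \<open>p\<close> and \<open>q\<close> these points give the Galois
  conjugates. Lattice functions vanish at all others, so identities between multipliers are needed
  only here.\<close>

definition good :: "nat \<Rightarrow> nat \<Rightarrow> int \<times> int \<Rightarrow> bool" where
  "good p q x \<longleftrightarrow> \<not> int p dvd fst x \<and> \<not> int q dvd snd x"

lemma sine_lattice_vanishes:
  assumes "f \<in> sine_lattice p q" "\<not> good p q x"
  shows "f x = 0"
proof -
  have *: "sn n (i * a) = 0" if "int n dvd a" for n i a
  proof -
    have "[i * a = 0] (mod int n)" using that by (simp add: cong_0_iff)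
    from sn_cs_cong(1)[OF this] show ?thesis by simp
  qed
  show ?thesis using assms(1) by induction (use assms(2) in \<open>auto simp: good_def *\<close>)
qed

text \<open>The multiplier ring of the lattice takes the place of a ring of algebraic integers; a
  unit is a multiplier with another multiplier as its inverse at the good points.\<close>

definition sine_mult :: "nat \<Rightarrow> nat \<Rightarrow> (int \<times> int \<Rightarrow> real) set" where
  "sine_mult p q = {c. \<forall>f\<in>sine_lattice p q. (\<lambda>x. c x * f x) \<in> sine_lattice p q}"

lemma sine_multD: "c \<in> sine_mult p q \<Longrightarrow> f \<in> sine_lattice p q \<Longrightarrow> (\<lambda>x. c x * f x) \<in> sine_lattice p q"
  by (simp add: sine_mult_def)

lemma sine_mult_cong:
  assumes "c \<in> sine_mult p q" "\<And>x. good p q x \<Longrightarrow> c x = d x"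
  shows "d \<in> sine_mult p q"
  unfolding sine_mult_def
proof safe
  fix f assume f: "f \<in> sine_lattice p q"
  have "(\<lambda>x. d x * f x) = (\<lambda>x. c x * f x)"
    using assms(2) sine_lattice_vanishes[OF f] by fastforce
  then show "(\<lambda>x. d x * f x) \<in> sine_lattice p q" using sine_multD[OF assms(1) f] by simp
qed

lemma sine_multI_basic:
  assumes "\<And>i j. (\<lambda>x. c x * (sn p (i * fst x) * sn q (j * snd x))) \<in> sine_lattice p q"
  shows "c \<in> sine_mult p q"
  unfolding sine_mult_def
proof safe
  fix f assume "f \<in> sine_lattice p q"
  then show "(\<lambda>x. c x * f x) \<in> sine_lattice p q"
  proof induction
    case (plus h i j)
    from sine_lattice_add[OF plus.IH assms[of i j]] show ?case by (simp add: algebra_simps)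
  next
    case (minus h i j)
    from sine_lattice_diff[OF minus.IH assms[of i j]] show ?case by (simp add: algebra_simps)
  qed (simp add: sine_lattice.zero)
qed

lemma sine_mult_0: "(\<lambda>x. 0) \<in> sine_mult p q"
  and sine_mult_1: "(\<lambda>x. 1) \<in> sine_mult p q"
  by (auto simp: sine_mult_def intro: sine_lattice.zero)

lemma sine_mult_diff: "c \<in> sine_mult p q \<Longrightarrow> d \<in> sine_mult p q \<Longrightarrow> (\<lambda>x. c x - d x) \<in> sine_mult p q"
  by (auto simp: sine_mult_def ring_distribs intro: sine_lattice_diff)

lemma sine_mult_mult: "c \<in> sine_mult p q \<Longrightarrow> d \<in> sine_mult p q \<Longrightarrow> (\<lambda>x. c x * d x) \<in> sine_mult p q"
  by (auto simp: sine_mult_def mult.assoc)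

lemma sine_mult_swap:
  assumes "c \<in> sine_mult p q"
  shows "(\<lambda>x. c (prod.swap x)) \<in> sine_mult q p"
  unfolding sine_mult_def
proof safe
  fix f assume "f \<in> sine_lattice q p"
  from sine_lattice_swap[OF sine_multD[OF assms sine_lattice_swap[OF this]]]
  show "(\<lambda>x. c (prod.swap x) * f x) \<in> sine_lattice q p" by simp
qed

text \<open>Twice a cosine times a sine of frequency \<open>i\<close> is the sum of the sines of
  frequencies \<open>i + j\<close> and \<open>i - j\<close>; the factor 2 keeps the coefficients
  integral.\<close>

lemma sine_mult_cs: "(\<lambda>x. 2 * cs p (j * fst x)) \<in> sine_mult p q"
proof (rule sine_multI_basic)
  fix i l
  have "(\<lambda>x. 2 * cs p (j * fst x) * (sn p (i * fst x) * sn q (l * snd x)))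
      = (\<lambda>x. sn p ((i + j) * fst x) * sn q (l * snd x) + sn p ((i - j) * fst x) * sn q (l * snd x))"
  proof
    fix x :: "int \<times> int"
    show "2 * cs p (j * fst x) * (sn p (i * fst x) * sn q (l * snd x))
      = sn p ((i + j) * fst x) * sn q (l * snd x) + sn p ((i - j) * fst x) * sn q (l * snd x)"
      unfolding mult.assoc[symmetric] sn_times_cs by (simp add: algebra_simps)
  qed
  also have "\<dots> \<in> sine_lattice p q"
    by (intro sine_lattice_add sine_lattice_basic)
  finally show "(\<lambda>x. 2 * cs p (j * fst x) * (sn p (i * fst x) * sn q (l * snd x))) \<in> sine_lattice p q" .
qed

lemma not_dvd_mult_prime:
  "prime p \<Longrightarrow> \<not> int p dvd j \<Longrightarrow> \<not> int p dvd a \<Longrightarrow> \<not> int p dvd j * a"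
  by (simp add: prime_dvd_mult_iff)

text \<open>The quotients are cyclotomic units, polynomials in \<open>2 * cs p (j * fst x)\<close>. Where the
  denominator vanishes, \<open>x / 0 = 0\<close>, but a multiplier only matters at good points.\<close>

lemma sine_mult_ratio:
  assumes p: "prime p" "odd p" and j: "\<not> int p dvd j"
  shows "(\<lambda>x. sn p (i * fst x) / sn p (j * fst x)) \<in> sine_mult p q"
proof -
  have nz: "sn p (j * fst x) \<noteq> 0" if "good p q x" for x
    using that p j by (simp add: sn_eq_0_iff good_def not_dvd_mult_prime)
  \<comment> \<open>Multiples of \<open>j\<close> first, by the recurrence
    \<open>sin ((r + 2) t) = 2 cos t sin ((r + 1) t) - sin (r t)\<close>.\<close>
  have r: "(\<lambda>x. sn p (int r * j * fst x) / sn p (j * fst x)) \<in> sine_mult p q" for r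
  proof (induction r rule: induct_nat_012)
    case 0
    then show ?case by (simp add: sine_mult_0)
  next
    case 1
    show ?case by (rule sine_mult_cong[OF sine_mult_1]) (use nz in auto)
  next
    case (ge2 r)
    have "(\<lambda>x. 2 * cs p (j * fst x) * (sn p (int (Suc r) * j * fst x) / sn p (j * fst x))
        - sn p (int r * j * fst x) / sn p (j * fst x)) \<in> sine_mult p q"
      by (intro sine_mult_diff sine_mult_mult[OF sine_mult_cs] ge2)
    also have "(\<lambda>x::int \<times> int. 2 * cs p (j * fst x) * (sn p (int (Suc r) * j * fst x) / sn p (j * fst x))
        - sn p (int r * j * fst x) / sn p (j * fst x))
      = (\<lambda>x. sn p (int (Suc (Suc r)) * j * fst x) / sn p (j * fst x))"
    proof
      fix x :: "int \<times> int"
      have "2 * cs p (j * fst x) * sn p (int (Suc r) * j * fst x) - sn p (int r * j * fst x)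
        = sn p (int (Suc (Suc r)) * j * fst x)"
        unfolding sn_times_cs by (simp add: algebra_simps)
      then show "2 * cs p (j * fst x) * (sn p (int (Suc r) * j * fst x) / sn p (j * fst x))
          - sn p (int r * j * fst x) / sn p (j * fst x)
        = sn p (int (Suc (Suc r)) * j * fst x) / sn p (j * fst x)"
        by (simp only: times_divide_eq_right diff_divide_distrib[symmetric])
    qed
    finally show ?case .
  qed
  \<comment> \<open>As \<open>j\<close> is invertible modulo \<open>p\<close>, any \<open>i\<close>
    is congruent to a natural multiple \<open>t * j\<close>.\<close>
  have "coprime j (int p)"
    using p j by (metis coprime_commute prime_imp_coprime prime_nat_int_transfer)
  then obtain s where s: "[j * s = 1] (mod int p)"
    using cong_solve_coprime_int by blast
  define t where "t = nat ((s * i) mod int p)"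
  have p0: "p > 0" using p by (simp add: prime_gt_0_nat)
  have "[int t * j = i] (mod int p)"
  proof -
    have "[int t = s * i] (mod int p)" using p0 by (simp add: t_def)
    then have "[int t * j = s * i * j] (mod int p)" by (rule cong_scalar_right)
    also have "s * i * j = j * s * i" by simp
    also have "[j * s * i = 1 * i] (mod int p)" by (rule cong_scalar_right[OF s])
    finally show ?thesis by simp
  qed
  then have "sn p (int t * j * a) = sn p (i * a)" for a
    by (intro sn_cs_cong cong_scalar_right)
  with r[of t] show ?thesis by simp
qed

section \<open>Orbits of a primitive root and twisted shifts\<close>

text \<open>Since \<open>g\<close> has order \<open>p - 1\<close>, the residues of
  \<open>g ^ l * y\<close> are distinct; they are nonzero, so by counting they are all the nonzero
  residues.\<close>

lemma prod_primroot_powers: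
  fixes F :: "int \<Rightarrow> 'a::comm_monoid_mult"
  assumes p: "prime p" and g: "residue_primroot p g" and y: "\<not> int p dvd y"
    and F: "\<And>x x'. [x = x'] (mod int p) \<Longrightarrow> F x = F x'"
  shows "(\<Prod>l<p-1. F (int g ^ l * y)) = (\<Prod>j\<in>{1..<int p}. F j)"
proof -
  have p1: "p > 1" using p by (rule prime_gt_1_nat)
  have cop: "coprime p g" and ord: "ord p g = p - 1"
    using g p by (auto simp: residue_primroot_def totient_prime)
  have pi: "prime (int p)" using p by simp
  have ndvd: "\<not> int p dvd int g"
    using cop p1 by (auto simp: coprime_absorb_left)
  let ?r = "\<lambda>l. (int g ^ l * y) mod int p"
  have inj: "inj_on ?r {..<p-1}"
  proof (rule inj_onI)
    fix l l' assume l: "l \<in> {..<p-1}" "l' \<in> {..<p-1}" "?r l = ?r l'"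
    have "coprime y (int p)"
      using pi y by (metis coprime_commute prime_imp_coprime)
    with l(3) have "[int g ^ l = int g ^ l'] (mod int p)"
      unfolding cong_def[symmetric] by (metis cong_mult_rcancel)
    then have "[g ^ l = g ^ l'] (mod p)"
      by (metis cong_int_iff of_nat_power)
    then have "[l = l'] (mod ord p g)"
      using order_divides_expdiff[OF cop] by blast
    then show "l = l'" using l(1,2) unfolding ord by (simp add: cong_def)
  qed
  have "?r ` {..<p-1} \<subseteq> {1..<int p}"
  proof safe
    fix l
    have "\<not> int p dvd int g ^ l * y"
      using pi y ndvd by (metis prime_dvd_mult_iff prime_dvd_power)
    then have "?r l \<noteq> 0" by (simp add: dvd_eq_mod_eq_0)
    moreover have "?r l \<ge> 0" "?r l < int p" using p1 by auto
    ultimately show "?r l \<in> {1..<int p}" by simp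
  qed
  then have "?r ` {..<p-1} = {1..<int p}"
    using p1 card_image[OF inj] by (intro card_subset_eq) (auto simp: nat_diff_distrib)
  with inj have "bij_betw ?r {..<p-1} {1..<int p}" by (simp add: bij_betw_def)
  from prod.reindex_bij_betw[OF this, of F]
  have "(\<Prod>l<p-1. F (?r l)) = (\<Prod>j\<in>{1..<int p}. F j)" .
  moreover have "F (?r l) = F (int g ^ l * y)" for l
    by (rule F) simp
  ultimately show ?thesis by simp
qed

definition twist :: "(int \<times> int \<Rightarrow> real) \<Rightarrow> int \<Rightarrow> (int \<times> int \<Rightarrow> real) \<Rightarrow> int \<times> int \<Rightarrow> real" where
  "twist c g f x = c x * f (g * fst x, snd x)"

lemma twist_in_lattice:
  "c \<in> sine_mult p q \<Longrightarrow> f \<in> sine_lattice p q \<Longrightarrow> twist c g f \<in> sine_lattice p q"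
  unfolding twist_def[abs_def] by (intro sine_multD sine_lattice_shift)

lemma twist_funpow_in_lattice:
  "c \<in> sine_mult p q \<Longrightarrow> f \<in> sine_lattice p q \<Longrightarrow> (twist c g ^^ l) f \<in> sine_lattice p q"
  by (induction l) (auto intro: twist_in_lattice)

text \<open>Each application moves the earlier coefficients one step along the orbit of
  \<open>g\<close>, so powers accumulate a partial norm of \<open>c\<close>.\<close>

lemma twist_funpow:
  "(twist c g ^^ l) f x = (\<Prod>i<l. c (g ^ i * fst x, snd x)) * f (g ^ l * fst x, snd x)"
proof (induction l arbitrary: x)
  case (Suc l)
  have "(\<Prod>i<Suc l. c (g ^ i * fst x, snd x)) = c x * (\<Prod>i<l. c (g ^ i * (g * fst x), snd x))"
    unfolding prod.lessThan_Suc_shift by (simp add: algebra_simps)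
  with Suc.IH[of "(g * fst x, snd x)"] show ?case
    by (simp add: twist_def algebra_simps)
qed simp

text \<open>After a full period the shift disappears and only multiplication by the norm of
  \<open>c\<close> remains.\<close>

lemma twist_funpow_period:
  assumes "f \<in> sine_lattice p q" "[g ^ N = 1] (mod int p)"
  shows "(twist c g ^^ N) f x = (\<Prod>i<N. c (g ^ i * fst x, snd x)) * f x"
proof -
  have "[g ^ N * fst x = 1 * fst x] (mod int p)"
    using assms(2) by (rule cong_scalar_right)
  from sine_lattice_periodic[OF assms(1) this, of "snd x"] show ?thesis
    by (simp add: twist_funpow)
qed

text \<open>The \<open>N\<close>-th power of the twist is multiplication by the norm, so the power
  \<open>N - 1\<close> applied to \<open>w * h\<close> is a preimage of \<open>h\<close>.\<close>

lemma twist_surj: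
  assumes c: "c \<in> sine_mult p q" and w: "w \<in> sine_mult p q" and N: "N > 0" "[g ^ N = 1] (mod int p)"
    and inv: "\<And>x. good p q x \<Longrightarrow> w x * (\<Prod>i<N. c (g ^ i * fst x, snd x)) = 1"
    and h: "h \<in> sine_lattice p q"
  obtains f where "f \<in> sine_lattice p q" "\<And>x. twist c g f x = h x"
proof
  let ?h = "\<lambda>x. w x * h x"
  have h': "?h \<in> sine_lattice p q" by (rule sine_multD[OF w h])
  let ?f = "(twist c g ^^ (N - 1)) ?h"
  show "?f \<in> sine_lattice p q" by (rule twist_funpow_in_lattice[OF c h'])
  fix x
  have "twist c g ?f x = (twist c g ^^ N) ?h x"
    using N(1) by (cases N) auto
  also have "\<dots> = (w x * (\<Prod>i<N. c (g ^ i * fst x, snd x))) * h x"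
    unfolding twist_funpow_period[OF h' N(2)] by simp
  also have "\<dots> = h x"
    using inv[of x] sine_lattice_vanishes[OF h, of x] by (cases "good p q x") simp_all
  finally show "twist c g ?f x = h x" .
qed

text \<open>Geometric series for the inverse of \<open>1 + twist c g\<close>.\<close>

lemma one_plus_twist_surj:
  assumes c: "c \<in> sine_mult p q" and w: "w \<in> sine_mult p q" and N: "even N" "[g ^ N = 1] (mod int p)"
    and inv: "\<And>x. good p q x \<Longrightarrow> w x * (1 - (\<Prod>i<N. c (g ^ i * fst x, snd x))) = 1"
    and h: "h \<in> sine_lattice p q"
  obtains f where "f \<in> sine_lattice p q" "\<And>x. f x + twist c g f x = h x"
proof
  let ?h = "\<lambda>x. w x * h x"
  have h': "?h \<in> sine_lattice p q" by (rule sine_multD[OF w h])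
  \<comment> \<open>The sign change turns \<open>1 + twist c g\<close> into
    \<open>1 - twist d g\<close>, the form that telescopes.\<close>
  define d where "d x = - c x" for x
  have d: "d \<in> sine_mult p q"
    using sine_mult_diff[OF sine_mult_0 c] by (simp add: d_def[abs_def])
  let ?F = "\<lambda>l. (twist d g ^^ l) ?h"
  let ?f = "\<lambda>x. \<Sum>l<N. ?F l x"
  show "?f \<in> sine_lattice p q"
    by (intro sine_lattice_sum twist_funpow_in_lattice[OF d h'])
  fix x
  have "?f x + twist c g ?f x = (\<Sum>l<N. ?F l x) - (\<Sum>l<N. twist d g (?F l) x)"
    unfolding twist_def by (simp add: sum_distrib_left d_def sum_negf)
  also have "\<dots> = (\<Sum>l<N. ?F l x - ?F (Suc l) x)"
    by (simp add: sum_subtractf)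
  also have "\<dots> = ?h x - ?F N x"
    by (subst sum_lessThan_telescope') simp
  \<comment> \<open>With \<open>N\<close> even, \<open>c\<close> and \<open>d\<close> have the same
    norm.\<close>
  also have "?F N x = (\<Prod>i<N. c (g ^ i * fst x, snd x)) * ?h x"
    using N(1) unfolding twist_funpow_period[OF h' N(2)] by (simp add: d_def prod_uminus)
  also have "?h x - \<dots> = (w x * (1 - (\<Prod>i<N. c (g ^ i * fst x, snd x)))) * h x"
    by (simp add: algebra_simps)
  also have "\<dots> = h x"
    using inv[of x] sine_lattice_vanishes[OF h, of x] by (cases "good p q x") simp_all
  finally show "?f x + twist c g ?f x = h x" .
qed

section \<open>A product formula for differences of cosines\<close>

text \<open>The polynomial \<open>P\<close> is monic and has no repeated root: its derivative
  vanishes at most at 0, which is no root of \<open>P\<close>. So it is the product of the linear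
  factors of the roots of unity.\<close>

lemma prod_diff_roots_unity:
  fixes z :: complex
  assumes n: "n > 0"
  shows "(\<Prod>k<n. z - cis (2 * pi * real k / real n)) = z ^ n - 1"
proof -
  define P :: "complex poly" where "P = Polynomial.monom 1 n - 1"
  have deg: "degree P = n"
    using n degree_add_eq_left[of "- 1" "Polynomial.monom (1::complex) n"]
    by (simp add: P_def degree_monom_eq)
  have lc: "lead_coeff P = 1"
    using n by (simp add: deg) (simp add: P_def)
  have ev: "poly P x = x ^ n - 1" for x
    by (simp add: P_def poly_monom)
  have "rsquarefree P"
    unfolding rsquarefree_roots
  proof safe
    fix a assume a: "poly P a = 0" "poly (pderiv P) a = 0"
    have "pderiv P = Polynomial.monom (of_nat n) (n - 1)"
      by (simp add: P_def pderiv_diff pderiv_monom)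
    with a(2) n have "a ^ (n - 1) = 0" by (simp add: poly_monom)
    then have "a ^ n = 0" using n by (cases n) auto
    with a(1) show False by (simp add: ev)
  qed
  from complex_poly_decompose_rsquarefree[OF this]
  have "(\<Prod>w | poly P w = 0. [:- w, 1:]) = P" by (simp add: lc)
  then have "poly (\<Prod>w | w ^ n = 1. [:- w, 1:]) z = z ^ n - 1"
    by (simp add: ev)
  then have "(\<Prod>w | w ^ n = 1. z - w) = z ^ n - 1"
    by (simp add: poly_prod)
  then show ?thesis
    by (subst prod.reindex_bij_betw[OF bij_betw_roots_unity[OF n], of "\<lambda>w. z - w"])
qed

lemma cis_minus_1_squared: "(cis (2 * a) - 1)\<^sup>2 = - of_real (4 * (sin a)\<^sup>2) * cis (2 * a)"
proof -
  have "cis (2 * a) - 1 = (cis a - cis (- a)) * cis a"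
    by (simp add: algebra_simps cis_mult)
  also have "cis a - cis (- a) = 2 * \<i> * of_real (sin a)"
    by (simp add: complex_eq_iff)
  finally have "(cis (2 * a) - 1)\<^sup>2 = - of_real (4 * (sin a)\<^sup>2) * (cis a * cis a)"
    by (simp add: power2_eq_square algebra_simps)
  then show ?thesis by (simp add: cis_mult)
qed

text \<open>For \<open>z = cis (2 * \<theta>)\<close> the factors at a root of unity and at its
  conjugate multiply to \<open>z\<close> times a difference of cosines. Over all roots this gives
  \<open>(z ^ p - 1)\<^sup>2\<close>, which \<open>cis_minus_1_squared\<close> evaluates.\<close>

lemma prod_cos_diff:
  assumes p: "odd p" and s: "sin \<theta> \<noteq> 0"
  shows "(\<Prod>k=1..<p. 2 * cos (2 * pi * real k / real p) - 2 * cos (2 * \<theta>)) = (sin (real p * \<theta>) / sin \<theta>)\<^sup>2"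
proof -
  have p0: "p > 0" using p by (rule odd_pos)
  define z where "z = cis (2 * \<theta>)"
  let ?\<phi> = "\<lambda>k. 2 * pi * real k / real p"
  have zp: "z ^ p = cis (2 * (real p * \<theta>))"
    by (simp add: z_def DeMoivre mult.left_commute)
  have 1: "(\<Prod>k<p. z - cis (?\<phi> k)) = z ^ p - 1"
    by (rule prod_diff_roots_unity[OF p0])
  have "(\<Prod>k<p. z - cnj (cis (?\<phi> k))) = cnj (\<Prod>k<p. cnj z - cis (?\<phi> k))"
    by (simp add: cnj_prod)
  also have "\<dots> = z ^ p - 1"
    by (simp add: prod_diff_roots_unity[OF p0])
  finally have 2: "(\<Prod>k<p. z - cnj (cis (?\<phi> k))) = z ^ p - 1" .
  have factor: "(z - cis a) * (z - cnj (cis a)) = z * of_real (2 * cos (2 * \<theta>) - 2 * cos a)" for a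
  proof -
    have "z * cis (- 2 * \<theta>) = 1" by (simp add: z_def cis_mult)
    moreover have "cis a * cnj (cis a) = 1" by (simp add: cis_cnj cis_mult)
    ultimately have "(z - cis a) * (z - cnj (cis a)) = z * (z + cis (- 2 * \<theta>) - (cis a + cnj (cis a)))"
      by (simp add: algebra_simps)
    also have "z + cis (- 2 * \<theta>) - (cis a + cnj (cis a)) = of_real (2 * cos (2 * \<theta>) - 2 * cos a)"
      by (simp add: z_def complex_eq_iff)
    finally show ?thesis .
  qed
  have "(z ^ p - 1)\<^sup>2 = (\<Prod>k<p. z - cis (?\<phi> k)) * (\<Prod>k<p. z - cnj (cis (?\<phi> k)))"
    by (simp only: 1 2 power2_eq_square)
  also have "\<dots> = (\<Prod>k<p. z * of_real (2 * cos (2 * \<theta>) - 2 * cos (?\<phi> k)))"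
    unfolding prod.distrib[symmetric] factor ..
  also have "\<dots> = z ^ p * of_real (\<Prod>k<p. 2 * cos (2 * \<theta>) - 2 * cos (?\<phi> k))"
    by (simp add: prod.distrib)
  finally have "z ^ p * of_real (\<Prod>k<p. 2 * cos (2 * \<theta>) - 2 * cos (?\<phi> k))
      = z ^ p * (- of_real (4 * (sin (real p * \<theta>))\<^sup>2))"
    unfolding zp cis_minus_1_squared by (metis mult.commute)
  moreover have "z ^ p \<noteq> 0" by (simp add: z_def)
  ultimately have "complex_of_real (\<Prod>k<p. 2 * cos (2 * \<theta>) - 2 * cos (?\<phi> k))
      = of_real (- (4 * (sin (real p * \<theta>))\<^sup>2))"
    by (metis mult_left_cancel of_real_minus)
  then have "(\<Prod>k<p. 2 * cos (2 * \<theta>) - 2 * cos (?\<phi> k)) = - (4 * (sin (real p * \<theta>))\<^sup>2)"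
    by (simp only: of_real_eq_iff)
  \<comment> \<open>The factor for \<open>k = 0\<close> is split off; it supplies the denominator
    \<open>sin \<theta>\<close>.\<close>
  also have "(\<Prod>k<p. 2 * cos (2 * \<theta>) - 2 * cos (?\<phi> k))
      = (2 * cos (2 * \<theta>) - 2) * (\<Prod>k=1..<p. 2 * cos (2 * \<theta>) - 2 * cos (?\<phi> k))"
    using p0 by (simp add: lessThan_atLeast0 prod.atLeast_Suc_lessThan)
  also have "2 * cos (2 * \<theta>) - 2 = - (4 * (sin \<theta>)\<^sup>2)"
    by (simp add: cos_double_sin)
  \<comment> \<open>Reversing the differences costs no sign, as the number \<open>p - 1\<close> of
    factors is even.\<close>
  also have "(\<Prod>k=1..<p. 2 * cos (2 * \<theta>) - 2 * cos (?\<phi> k))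
      = (\<Prod>k=1..<p. (-1) * (2 * cos (?\<phi> k) - 2 * cos (2 * \<theta>)))"
    by simp
  also have "\<dots> = (\<Prod>k=1..<p. 2 * cos (?\<phi> k) - 2 * cos (2 * \<theta>))"
    unfolding prod.distrib using p by simp
  finally show ?thesis using s by (simp add: power_divide field_simps)
qed

section \<open>Orthogonality of sines and a basis of the lattice\<close>

text \<open>Multiplied by \<open>2 * sn n y\<close>, which is nonzero, the sum telescopes to a
  difference that vanishes by periodicity.\<close>

lemma sum_cs_eq_0:
  assumes n: "odd n" and y: "\<not> int n dvd y"
  shows "(\<Sum>x<n. cs n (y * int x)) = 0"
proof -
  let ?g = "\<lambda>x. sn n (y * int x) + sn n (y * (int x - 1))"
  have "2 * sn n y * (\<Sum>x<n. cs n (y * int x)) = (\<Sum>x<n. ?g (Suc x) - ?g x)"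
    unfolding sum_distrib_left
  proof (rule sum.cong[OF refl])
    fix x
    have "2 * cs n (y * int x) * sn n y = sn n (y + y * int x) + sn n (y - y * int x)"
      by (rule sn_times_cs)
    also have "sn n (y - y * int x) = - sn n (y * (int x - 1))"
      unfolding sn_minus[symmetric] by (simp add: algebra_simps)
    finally show "2 * sn n y * cs n (y * int x) = ?g (Suc x) - ?g x"
      by (simp add: algebra_simps)
  qed
  also have "\<dots> = ?g n - ?g 0"
    by (rule sum_lessThan_telescope)
  also have "\<dots> = 0"
  proof -
    have "[y * int n = y * 0] (mod int n)" "[y * (int n - 1) = y * (0 - 1)] (mod int n)"
      by (intro cong_scalar_left cong_diff; simp add: cong_def)+
    from this[THEN sn_cs_cong(1)] show ?thesis by simp
  qed
  finally show ?thesis using sn_eq_0_iff[OF n, of y] y by simp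
qed

lemma not_dvd_small: "0 < (y::int) \<Longrightarrow> y < int n \<Longrightarrow> \<not> int n dvd y"
  by (simp add: zdvd_not_zless)

text \<open>The product becomes a difference of cosines of frequencies \<open>i - j\<close> and
  \<open>i + j\<close>. Both are smaller than \<open>n\<close> in absolute value, so only
  \<open>i = j\<close> leaves a nonzero sum.\<close>

lemma sn_orthogonal:
  assumes n: "n = 2 * k + 1" and i: "i \<in> {1..int k}" and j: "j \<in> {1..int k}"
  shows "(\<Sum>x<n. sn n (i * int x) * sn n (j * int x)) = (if i = j then real n / 2 else 0)"
proof -
  have odd: "odd n" using n by simp
  have "2 * (\<Sum>x<n. sn n (i * int x) * sn n (j * int x))
      = (\<Sum>x<n. cs n ((i - j) * int x)) - (\<Sum>x<n. cs n ((i + j) * int x))"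
    unfolding sum_distrib_left sum_subtractf[symmetric] mult.assoc[symmetric] sn_times_sn
    by (simp add: algebra_simps)
  also have "(\<Sum>x<n. cs n ((i + j) * int x)) = 0"
    using i j n by (intro sum_cs_eq_0[OF odd] not_dvd_small) auto
  also have "(\<Sum>x<n. cs n ((i - j) * int x)) = (if i = j then real n else 0)"
  proof (cases "i = j")
    case True
    then show ?thesis by (simp add: cs_def)
  next
    case False
    have "\<not> int n dvd \<bar>i - j\<bar>"
      using False i j n by (intro not_dvd_small) auto
    with False show ?thesis using sum_cs_eq_0[OF odd, of "i - j"] by simp
  qed
  finally show ?thesis by (simp split: if_splits)
qed

text \<open>Periodicity brings the frequency below \<open>n\<close>, and reflection brings the upper
  half to the lower with a minus sign. The index \<open>r\<close> means frequency
  \<open>r + 1\<close>; residue 0 gets coefficient 0 at index 0.\<close>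

lemma sn_reduce:
  assumes n: "n = 2 * k + 1" and k: "k > 0"
  obtains s :: int and r where "r < k" "\<And>a. sn n (i * a) = of_int s * sn n (int (r + 1) * a)"
proof -
  let ?r = "i mod int n"
  have per: "sn n (i * a) = sn n (?r * a)" for a
    by (intro sn_cs_cong cong_scalar_right) simp
  have r: "?r \<ge> 0" "?r < int n" using n by auto
  consider "?r = 0" | "1 \<le> ?r" "?r \<le> int k" | "int k < ?r" using r by linarith
  then show ?thesis
  proof cases
    case 1
    then show ?thesis using that[of 0 0] k by (simp add: per)
  next
    case 2
    then show ?thesis using that[of "nat ?r - 1" 1] by (simp add: per of_nat_diff)
  next
    case 3
    have "sn n (?r * a) = - sn n ((int n - ?r) * a)" for a
    proof -
      have "[- ((int n - ?r) * a) = ?r * a] (mod int n)"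
        by (simp add: cong_iff_dvd_diff algebra_simps)
      from sn_cs_cong(1)[OF this] show ?thesis by simp
    qed
    moreover have "nat (int n - ?r) - 1 < k" "int (nat (int n - ?r) - 1 + 1) = int n - ?r"
      using 3 r n by linarith+
    ultimately show ?thesis using that[of "nat (int n - ?r) - 1" "-1"] per
      by (metis mult_minus_left mult_1 of_int_1 of_int_minus)
  qed
qed

text \<open>For odd \<open>q\<close>, quotient and remainder of \<open>r\<close> by
  \<open>q div 2\<close> encode a pair of indices. The shift by 1 avoids frequency 0, whose sine is
  identically zero.\<close>

definition sine_basis :: "nat \<Rightarrow> nat \<Rightarrow> nat \<Rightarrow> int \<times> int \<Rightarrow> real" where
  "sine_basis p q r x =
     sn p (int (r div (q div 2) + 1) * fst x) * sn q (int (r mod (q div 2) + 1) * snd x)"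

lemma int_span_scale_basis:
  assumes "r < n"
  shows "(\<lambda>x. of_int s * e r x) \<in> int_span n e"
proof -
  have "(\<Sum>i<n. of_int (if i = r then s else 0) * e i x) = of_int s * e r x" for x
    using assms by (simp add: if_distrib[of of_int] if_distrib[of "\<lambda>z. z * _"] cong: if_cong)
  then show ?thesis unfolding int_span_def
    by (intro CollectI exI[of _ "\<lambda>i. if i = r then s else 0"]) simp
qed

lemma int_span_add:
  assumes "f \<in> int_span n e" "h \<in> int_span n e"
  shows "(\<lambda>x. f x + h x) \<in> int_span n e"
proof -
  from assms obtain c d :: "nat \<Rightarrow> int" where
    "f = (\<lambda>x. \<Sum>i<n. of_int (c i) * e i x)" "h = (\<lambda>x. \<Sum>i<n. of_int (d i) * e i x)"
    by (auto simp: int_span_def)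
  then show ?thesis unfolding int_span_def
    by (intro CollectI exI[of _ "\<lambda>i. c i + d i"]) (simp add: sum.distrib algebra_simps)
qed

lemma sine_lattice_of_int:
  assumes "f \<in> sine_lattice p q"
  shows "(\<lambda>x. of_int c * f x) \<in> sine_lattice p q"
proof (induction c rule: int_induct[where k = 0])
  case base
  show ?case by (simp add: sine_lattice.zero)
next
  case (step1 i)
  from sine_lattice_add[OF step1(2) assms] show ?case by (simp add: algebra_simps)
next
  case (step2 i)
  from sine_lattice_diff[OF step2(2) assms] show ?case by (simp add: algebra_simps)
qed

context
  fixes p q k m :: nat
  assumes p: "p = 2 * k + 1" and q: "q = 2 * m + 1" and k: "k > 0" and m: "m > 0"
begin

lemma sine_product_in_span:
  "(\<lambda>x. of_int c * (sn p (i * fst x) * sn q (j * snd x))) \<in> int_span (k * m) (sine_basis p q)"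
proof -
  obtain s r where s: "r < k" "\<And>a. sn p (i * a) = of_int s * sn p (int (r + 1) * a)"
    using sn_reduce[OF p k, of i] by blast
  obtain s' r' where s': "r' < m" "\<And>a. sn q (j * a) = of_int s' * sn q (int (r' + 1) * a)"
    using sn_reduce[OF q m, of j] by blast
  \<comment> \<open>\<open>r * m + r'\<close> is the basis index of the pair of reduced
    frequencies.\<close>
  have "r * m + r' < Suc r * m" using s'(1) by simp
  also have "\<dots> \<le> k * m" using s(1) by (intro mult_le_mono1) simp
  finally have "(\<lambda>x. of_int (c * s * s') * sine_basis p q (r * m + r') x) \<in> int_span (k * m) (sine_basis p q)"
    by (rule int_span_scale_basis)
  moreover have "sine_basis p q (r * m + r') x = sn p (int (r + 1) * fst x) * sn q (int (r' + 1) * snd x)" for x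
    using s'(1) by (simp add: sine_basis_def q)
  ultimately show ?thesis by (simp add: s s' mult_ac)
qed

lemma int_span_sine_basis: "int_span (k * m) (sine_basis p q) = sine_lattice p q"
proof (rule equalityI)
  have "(\<lambda>x. of_int c * sine_basis p q i x) \<in> sine_lattice p q" for c i
    unfolding sine_basis_def by (intro sine_lattice_of_int sine_lattice_basic)
  then show "int_span (k * m) (sine_basis p q) \<subseteq> sine_lattice p q"
    unfolding int_span_def by (auto intro!: sine_lattice_sum)
next
  show "sine_lattice p q \<subseteq> int_span (k * m) (sine_basis p q)"
  proof
    fix f assume "f \<in> sine_lattice p q"
    then show "f \<in> int_span (k * m) (sine_basis p q)"
    proof induction
      case zero
      from sine_product_in_span[of 0 0 0] show ?case by simp
    next
      case (plus f i j)
      from int_span_add[OF plus.IH sine_product_in_span[of 1 i j]] show ?case by simp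
    next
      case (minus f i j)
      from int_span_add[OF minus.IH sine_product_in_span[of "-1" i j]] show ?case by simp
    qed
  qed
qed

text \<open>The double sum factors into one orthogonality sum for each prime.\<close>

lemma sine_basis_orthogonal:
  assumes "r < k * m" "s < k * m"
  shows "(\<Sum>a<p. \<Sum>b<q. sine_basis p q r (int a, int b) * sine_basis p q s (int a, int b))
    = (if r = s then real p * real q / 4 else 0)"
proof -
  have m': "q div 2 = m" using q by simp
  have dv: "r div m < k" "s div m < k"
    using assms by (auto simp: less_mult_imp_div_less)
  have md: "r mod m < m" "s mod m < m" using m by auto
  have mem: "int (r div m + 1) \<in> {1..int k}" "int (s div m + 1) \<in> {1..int k}"
    "int (r mod m + 1) \<in> {1..int m}" "int (s mod m + 1) \<in> {1..int m}"
    using dv md unfolding atLeastAtMost_iff by (intro conjI; linarith)+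
  have "(\<Sum>a<p. \<Sum>b<q. sine_basis p q r (int a, int b) * sine_basis p q s (int a, int b))
      = (\<Sum>a<p. sn p (int (r div m + 1) * int a) * sn p (int (s div m + 1) * int a))
        * (\<Sum>b<q. sn q (int (r mod m + 1) * int b) * sn q (int (s mod m + 1) * int b))"
    unfolding sum_product by (simp add: sine_basis_def m' mult_ac)
  also have "\<dots> = (if r div m = s div m then real p / 2 else 0) * (if r mod m = s mod m then real q / 2 else 0)"
    unfolding sn_orthogonal[OF p mem(1,2)] sn_orthogonal[OF q mem(3,4)] by simp
  also have "\<dots> = (if r = s then real p * real q / 4 else 0)"
  proof -
    have "r = s" if "r div m = s div m" "r mod m = s mod m"
      using that by (metis div_mult_mod_eq)
    then show ?thesis by auto
  qed
  finally show ?thesis .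
qed

text \<open>Pairing a vanishing combination with \<open>?e s\<close> over all residues isolates
  \<open>c s\<close>.\<close>

lemma sine_basis_independent:
  fixes c :: "nat \<Rightarrow> int"
  assumes "\<And>x. (\<Sum>i<k*m. of_int (c i) * sine_basis p q i x) = 0"
  shows "\<forall>i<k*m. c i = 0"
proof safe
  fix s assume s: "s < k * m"
  let ?e = "sine_basis p q"
  have "0 = (\<Sum>a<p. \<Sum>b<q. (\<Sum>i<k*m. of_int (c i) * ?e i (int a, int b)) * ?e s (int a, int b))"
    by (simp add: assms)
  also have "\<dots> = (\<Sum>a<p. \<Sum>i<k*m. \<Sum>b<q. of_int (c i) * (?e i (int a, int b) * ?e s (int a, int b)))"
    by (subst sum.swap) (simp add: sum_distrib_right mult.assoc)
  also have "\<dots> = (\<Sum>i<k*m. of_int (c i) * (\<Sum>a<p. \<Sum>b<q. ?e i (int a, int b) * ?e s (int a, int b)))"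
    by (subst sum.swap) (simp add: sum_distrib_left)
  also have "\<dots> = (\<Sum>i<k*m. of_int (c i) * (if i = s then real p * real q / 4 else 0))"
    by (intro sum.cong refl) (simp add: sine_basis_orthogonal s)
  also have "\<dots> = of_int (c s) * (real p * real q / 4)"
    using s by (simp add: if_distrib[of "\<lambda>z. _ * z"] cong: if_cong)
  finally show "c s = 0" using p q by simp
qed

end

section \<open>Cyclotomic units and their norms\<close>

lemma sine_mult_ratio_snd:
  assumes "prime q" "odd q" "\<not> int q dvd j"
  shows "(\<lambda>x. sn q (i * snd x) / sn q (j * snd x)) \<in> sine_mult p q"
  using sine_mult_swap[OF sine_mult_ratio[OF assms, of i p]] by simp

lemma sine_mult_cs_snd: "(\<lambda>x. 2 * cs q (j * snd x)) \<in> sine_mult p q"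
  using sine_mult_swap[OF sine_mult_cs[of q j p]] by simp

lemma sn_squares_diff: "(sn n x)\<^sup>2 - (sn n y)\<^sup>2 = sn n (x - y) * sn n (x + y)"
  using sn_times_sn[of n x x] sn_times_sn[of n y y] sn_times_sn[of n "x - y" "x + y"]
  by (simp add: power2_eq_square cs_def algebra_simps)

text \<open>The numerator of a difference of two sine quotients. That it is again a product of sines
  is what makes the difference a cyclotomic unit.\<close>

lemma sn_ratio_diff:
  "sn n ((i + 1) * a) * sn n (j * a) - sn n ((j + 1) * a) * sn n (i * a) = sn n a * sn n ((j - i) * a)"
proof -
  have "cs n ((i - j - 1) * a) = cs n (- ((i - j - 1) * a))" by (simp add: cs_def)
  then show ?thesis
    using sn_times_sn[of n "(i + 1) * a" "j * a"] sn_times_sn[of n "(j + 1) * a" "i * a"]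
      sn_times_sn[of n a "(j - i) * a"]
    by (simp add: algebra_simps)
qed

text \<open>The function \<open>u\<^sub>i\<close> of the overview.\<close>

definition sine_quotient :: "nat \<Rightarrow> int \<Rightarrow> int \<times> int \<Rightarrow> real" where
  "sine_quotient p i x = sn p ((i + 1) * fst x) / sn p (i * fst x)"

text \<open>The function \<open>\<tau>\<close> of the overview. The doubled second angle matches the
  \<open>2 * \<theta>\<close> of \<open>prod_cos_diff\<close>.\<close>

definition cos_gap :: "nat \<Rightarrow> nat \<Rightarrow> int \<times> int \<Rightarrow> real" where
  "cos_gap p q x = 2 * cs p (fst x) - 2 * cs q (2 * snd x)"

text \<open>Its square is the norm of \<open>cos_gap\<close> over the conjugates in the \<open>p\<close>-direction.\<close>

definition norm_root :: "nat \<Rightarrow> nat \<Rightarrow> int \<times> int \<Rightarrow> real" where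
  "norm_root p q x = sn q (int p * snd x) / sn q (snd x)"

lemma cos_gap_mult: "cos_gap p q \<in> sine_mult p q"
  unfolding cos_gap_def[abs_def]
  using sine_mult_diff[OF sine_mult_cs[of p 1 q] sine_mult_cs_snd[of q 2 p]] by simp

context
  fixes p q g :: nat
  assumes p: "prime p" "odd p" and q: "prime q" "odd q" and pq: "p \<noteq> q"
    and pq1: "\<not> [int p = 1] (mod int q)" and pq2: "\<not> [int p = - 1] (mod int q)"
    and g: "residue_primroot p g"
begin

lemma primroot_not_dvd: "\<not> int p dvd int g ^ l"
proof -
  have "coprime p g" using g by (simp add: residue_primroot_def)
  then have "\<not> p dvd g" using prime_gt_1_nat[OF p(1)] by (auto simp: coprime_absorb_left)
  then show ?thesis using p(1) by (metis int_dvd_int_iff prime_dvd_power prime_nat_int_transfer)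
qed

lemma primroot_power: "[int g ^ (p - 1) = 1] (mod int p)"
proof -
  have "ord p g = p - 1" using g p by (simp add: residue_primroot_def totient_prime)
  then have "[g ^ (p - 1) = 1] (mod p)" by (metis ord_divides dvd_refl)
  then show ?thesis by (metis cong_int_iff of_nat_1 of_nat_power)
qed

lemma good_shift: "good p q x \<Longrightarrow> good p q (int g ^ l * fst x, snd x)"
  using primroot_not_dvd p(1) by (simp add: good_def not_dvd_mult_prime)

text \<open>Conjugates are listed along the orbit of \<open>g\<close>, as they arise when
  \<open>twist\<close> is iterated.\<close>

definition conj_norm :: "(int \<times> int \<Rightarrow> real) \<Rightarrow> int \<times> int \<Rightarrow> real" where
  "conj_norm c x = (\<Prod>l<p-1. c (int g ^ l * fst x, snd x))"

lemma conj_norm_mult: "conj_norm (\<lambda>x. c x * d x) x = conj_norm c x * conj_norm d x"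
  by (simp add: conj_norm_def prod.distrib)

lemma conj_norm_cong:
  "good p q x \<Longrightarrow> (\<And>y. good p q y \<Longrightarrow> c y = d y) \<Longrightarrow> conj_norm c x = conj_norm d x"
  unfolding conj_norm_def by (intro prod.cong refl) (simp add: good_shift)

lemma conj_norm_0: "conj_norm (\<lambda>x. 0) x = 0"
  using prime_gt_1_nat[OF p(1)] by (simp add: conj_norm_def)

lemma sn_fst_nonzero: "good p q x \<Longrightarrow> \<not> int p dvd i \<Longrightarrow> sn p (i * fst x) \<noteq> 0"
  using p by (simp add: good_def sn_eq_0_iff not_dvd_mult_prime)

lemma sn_snd_nonzero: "good p q x \<Longrightarrow> \<not> int q dvd i \<Longrightarrow> sn q (i * snd x) \<noteq> 0"
  using q by (simp add: good_def sn_eq_0_iff not_dvd_mult_prime)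

text \<open>Numerator and denominator have the same norm, the product of the sines at all nonzero
  residues.\<close>

lemma conj_norm_ratio:
  assumes x: "good p q x" and i: "\<not> int p dvd i" and j: "\<not> int p dvd j"
  shows "conj_norm (\<lambda>x. sn p (i * fst x) / sn p (j * fst x)) x = 1"
proof -
  have *: "(\<Prod>l<p-1. sn p (i * (int g ^ l * fst x))) = (\<Prod>j\<in>{1..<int p}. sn p j)"
    if i: "\<not> int p dvd i" for i
  proof -
    have "\<not> int p dvd i * fst x"
      using p(1) i x by (simp add: good_def not_dvd_mult_prime)
    from prod_primroot_powers[OF p(1) g this sn_cs_cong(1)] show ?thesis
      by (simp add: mult.left_commute)
  qed
  have "(\<Prod>j\<in>{1..<int p}. sn p j) \<noteq> 0"
    using p(2) by (simp add: sn_eq_0_iff zdvd_not_zless)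
  then show ?thesis
    by (simp only: conj_norm_def prod_dividef fst_conv *[OF i] *[OF j]) simp
qed

lemma conj_norm_cos_gap:
  assumes x: "good p q x"
  shows "conj_norm (cos_gap p q) x = (norm_root p q x)\<^sup>2"
proof -
  let ?\<theta> = "2 * pi * of_int (snd x) / real q"
  have "?\<theta> = ?\<theta> \<and> sin ?\<theta> \<noteq> 0"
    using sn_snd_nonzero[OF x, of 1] prime_gt_1_nat[OF q(1)] by (simp add: sn_def)
  then have s: "sin ?\<theta> \<noteq> 0" by blast
  have "conj_norm (cos_gap p q) x = (\<Prod>j\<in>{1..<int p}. 2 * cs p j - 2 * cs q (2 * snd x))"
    unfolding conj_norm_def cos_gap_def fst_conv snd_conv
    using x by (intro prod_primroot_powers[OF p(1) g]) (auto simp: good_def dest: sn_cs_cong(2))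
  also have "\<dots> = (\<Prod>k=1..<p. 2 * cs p (int k) - 2 * cs q (2 * snd x))"
    by (rule prod.reindex_bij_witness[of _ int nat]) auto
  also have "\<dots> = (\<Prod>k=1..<p. 2 * cos (2 * pi * real k / real p) - 2 * cos (2 * ?\<theta>))"
    by (simp add: cs_def mult_ac)
  also have "\<dots> = (sin (real p * ?\<theta>) / sin ?\<theta>)\<^sup>2"
    by (rule prod_cos_diff[OF p(2) s])
  also have "\<dots> = (norm_root p q x)\<^sup>2"
    by (simp add: norm_root_def sn_def mult_ac)
  finally show ?thesis .
qed

text \<open>As \<open>p\<close> and \<open>q\<close> are distinct primes, \<open>q\<close> does not
  divide \<open>p\<close>, and the inverted quotient is a multiplier too.\<close>

lemma norm_root_square_unit:
  obtains w where "w \<in> sine_mult p q" "\<And>x. good p q x \<Longrightarrow> w x * (norm_root p q x)\<^sup>2 = 1"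
proof
  have nd: "\<not> int q dvd int p"
    using p(1) q(1) pq by (simp add: primes_dvd_imp_eq) (metis primes_dvd_imp_eq)
  let ?v = "\<lambda>x. sn q (1 * snd x) / sn q (int p * snd x)"
  have v: "?v \<in> sine_mult p q" by (rule sine_mult_ratio_snd[OF q nd])
  show "(\<lambda>x. ?v x * ?v x) \<in> sine_mult p q" by (rule sine_mult_mult[OF v v])
  fix x assume x: "good p q x"
  have "\<not> int q dvd 1" using prime_gt_1_nat[OF q(1)] by simp
  from sn_snd_nonzero[OF x this] sn_snd_nonzero[OF x nd]
  show "?v x * ?v x * (norm_root p q x)\<^sup>2 = 1"
    by (simp add: norm_root_def power2_eq_square)
qed

text \<open>The difference of squares of sines factors with frequencies \<open>1 - p\<close> and
  \<open>1 + p\<close>; the two congruence hypotheses say that \<open>q\<close> divides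
  neither.\<close>

lemma one_minus_norm_root_square_unit:
  obtains w where "w \<in> sine_mult p q" "\<And>x. good p q x \<Longrightarrow> w x * (1 - (norm_root p q x)\<^sup>2) = 1"
proof
  have nd1: "\<not> int q dvd 1 - int p"
    using pq1 by (simp add: cong_iff_dvd_diff dvd_diff_commute)
  have nd2: "\<not> int q dvd 1 + int p"
    using pq2 by (simp add: cong_iff_dvd_diff add.commute)
  have nd3: "\<not> int q dvd 1" using prime_gt_1_nat[OF q(1)] by simp
  let ?v = "\<lambda>i x. sn q (1 * snd x) / sn q (i * snd x)"
  show "(\<lambda>x. ?v (1 - int p) x * ?v (1 + int p) x) \<in> sine_mult p q"
    by (intro sine_mult_mult sine_mult_ratio_snd[OF q] nd1 nd2)
  fix x assume x: "good p q x"
  let ?s = "sn q (snd x)"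
  have s: "?s \<noteq> 0" using sn_snd_nonzero[OF x nd3] by simp
  have "?s\<^sup>2 - (sn q (int p * snd x))\<^sup>2 = sn q ((1 - int p) * snd x) * sn q ((1 + int p) * snd x)"
    unfolding sn_squares_diff by (simp add: algebra_simps)
  then have "1 - (norm_root p q x)\<^sup>2 = sn q ((1 - int p) * snd x) * sn q ((1 + int p) * snd x) / ?s\<^sup>2"
    using s by (metis (no_types, lifting) diff_divide_distrib divide_self norm_root_def power_divide power_not_zero)
  with s sn_snd_nonzero[OF x nd1] sn_snd_nonzero[OF x nd2]
  show "?v (1 - int p) x * ?v (1 + int p) x * (1 - (norm_root p q x)\<^sup>2) = 1"
    by (simp add: power2_eq_square)
qed

text \<open>Only the denominator has to be prime to \<open>p\<close>. At \<open>i = p - 1\<close>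
  the numerator vanishes, which is harmless since only differences must be invertible.\<close>

lemma sine_quotient_mult: "i \<in> {1..<int p} \<Longrightarrow> sine_quotient p i \<in> sine_mult p q"
  unfolding sine_quotient_def[abs_def]
  by (intro sine_mult_ratio[OF p]) (simp add: zdvd_not_zless)

text \<open>By \<open>sn_ratio_diff\<close> the difference is a product of two sine quotients whose
  frequencies \<open>1\<close>, \<open>i\<close>, \<open>j - i\<close>, \<open>j\<close> are all
  prime to \<open>p\<close>. Each quotient has norm 1, and so does its inverse.\<close>

lemma sine_quotient_diff:
  assumes i: "i \<in> {1..<int p}" and j: "j \<in> {1..<int p}" and ij: "i \<noteq> j"
  shows "good p q x \<Longrightarrow> conj_norm (\<lambda>x. sine_quotient p i x - sine_quotient p j x) x = 1"
    and "\<exists>v\<in>sine_mult p q. \<forall>x. good p q x \<longrightarrow>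
      (sine_quotient p i x - sine_quotient p j x) * v x = 1 \<and> conj_norm v x = 1"
proof -
  let ?r = "\<lambda>i j x. sn p (i * fst x) / sn p (j * fst x) :: real"
  have nd: "\<not> int p dvd i" "\<not> int p dvd j" using i j by (simp_all add: zdvd_not_zless)
  have nd1: "\<not> int p dvd 1" using prime_gt_1_nat[OF p(1)] by simp
  have nd2: "\<not> int p dvd j - i"
  proof
    assume "int p dvd j - i"
    then have "int p dvd \<bar>j - i\<bar>" by simp
    moreover have "0 < \<bar>j - i\<bar>" "\<bar>j - i\<bar> < int p" using i j ij by auto
    ultimately show False by (metis zdvd_not_zless)
  qed
  have eq: "sine_quotient p i x - sine_quotient p j x = ?r 1 i x * ?r (j - i) j x"
    if x: "good p q x" for x
    using sn_ratio_diff[of p i "fst x" j] sn_fst_nonzero[OF x nd(1)] sn_fst_nonzero[OF x nd(2)]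
    by (simp add: sine_quotient_def diff_frac_eq)
  show "conj_norm (\<lambda>x. sine_quotient p i x - sine_quotient p j x) x = 1" if x: "good p q x"
  proof -
    have "conj_norm (\<lambda>x. sine_quotient p i x - sine_quotient p j x) x
      = conj_norm (\<lambda>x. ?r 1 i x * ?r (j - i) j x) x"
      by (rule conj_norm_cong[OF x eq])
    then show ?thesis
      by (simp only: conj_norm_mult conj_norm_ratio[OF x nd1 nd(1)] conj_norm_ratio[OF x nd2 nd(2)])
  qed
  show "\<exists>v\<in>sine_mult p q. \<forall>x. good p q x \<longrightarrow>
      (sine_quotient p i x - sine_quotient p j x) * v x = 1 \<and> conj_norm v x = 1"
  proof (intro bexI allI impI conjI)
    show "(\<lambda>x. ?r i 1 x * ?r j (j - i) x) \<in> sine_mult p q"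
      by (intro sine_mult_mult sine_mult_ratio[OF p] nd1 nd2)
    fix x assume x: "good p q x"
    show "(sine_quotient p i x - sine_quotient p j x) * (?r i 1 x * ?r j (j - i) x) = 1"
      unfolding eq[OF x]
      using sn_fst_nonzero[OF x nd1] sn_fst_nonzero[OF x nd2] sn_fst_nonzero[OF x nd(1)]
        sn_fst_nonzero[OF x nd(2)] by simp
    show "conj_norm (\<lambda>x. ?r i 1 x * ?r j (j - i) x) x = 1"
      by (simp only: conj_norm_mult conj_norm_ratio[OF x nd(1) nd1] conj_norm_ratio[OF x nd(2) nd2])
  qed
qed

section \<open>The operators of the clique and the resulting matrices\<close>

definition clique_operator :: "int \<times> int \<Rightarrow> (int \<times> int \<Rightarrow> real) \<Rightarrow> int \<times> int \<Rightarrow> real" where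
  "clique_operator i f x = sine_quotient p (fst i) x * f x
     + twist (\<lambda>x. sine_quotient p (snd i) x * cos_gap p q x) (int g) f x"

lemma clique_operator_lattice:
  assumes i: "i \<in> {1..<int p} \<times> {1..<int p}" and f: "f \<in> sine_lattice p q"
  shows "clique_operator i f \<in> sine_lattice p q"
  unfolding clique_operator_def[abs_def]
  using i by (intro sine_lattice_add sine_multD twist_in_lattice f sine_mult_mult sine_quotient_mult
      cos_gap_mult) auto

text \<open>The difference is \<open>\<alpha> + \<beta> \<tau> \<sigma>\<close>. If \<alpha> is
  zero, the norm of the twist is the unit \<open>t\<^sup>2\<close>; otherwise dividing by \<alpha>
  leaves one plus a twist of norm 0 or \<open>t\<^sup>2\<close>.\<close>

lemma clique_operator_diff_surj:
  assumes i: "i \<in> {1..<int p} \<times> {1..<int p}" and j: "j \<in> {1..<int p} \<times> {1..<int p}"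
    and ij: "i \<noteq> j" and h: "h \<in> sine_lattice p q"
  shows "\<exists>f\<in>sine_lattice p q. \<forall>x. clique_operator i f x - clique_operator j f x = h x"
proof -
  define \<alpha> where "\<alpha> x = sine_quotient p (fst i) x - sine_quotient p (fst j) x" for x
  define \<beta> where "\<beta> x = sine_quotient p (snd i) x - sine_quotient p (snd j) x" for x
  have \<alpha>: "\<alpha> \<in> sine_mult p q" and \<beta>: "\<beta> \<in> sine_mult p q"
    unfolding \<alpha>_def[abs_def] \<beta>_def[abs_def]
    using i j by (auto intro!: sine_mult_diff sine_quotient_mult)
  let ?c = "\<lambda>x. \<beta> x * cos_gap p q x"
  have c: "?c \<in> sine_mult p q" by (rule sine_mult_mult[OF \<beta> cos_gap_mult])
  have T: "clique_operator i f x - clique_operator j f x = \<alpha> x * f x + twist ?c (int g) f x" for f x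
    by (simp add: clique_operator_def twist_def \<alpha>_def \<beta>_def algebra_simps)
  have norm_\<beta>: "conj_norm \<beta> x = 1" if "snd i \<noteq> snd j" "good p q x" for x
    unfolding \<beta>_def[abs_def] using i j that by (intro sine_quotient_diff(1)) auto
  have p1: "p - 1 > 0" "even (p - 1)" using prime_gt_1_nat[OF p(1)] p(2) by auto
  show ?thesis
  proof (cases "fst i = fst j")
    case True
    with ij have "snd i \<noteq> snd j" by (metis prod.collapse)
    obtain w where w: "w \<in> sine_mult p q" "\<And>x. good p q x \<Longrightarrow> w x * (norm_root p q x)\<^sup>2 = 1"
      using norm_root_square_unit by blast
    have "w x * conj_norm ?c x = 1" if x: "good p q x" for x
      using w(2)[OF x] norm_\<beta>[OF \<open>snd i \<noteq> snd j\<close> x]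
      by (simp add: conj_norm_mult conj_norm_cos_gap[OF x])
    then obtain f where "f \<in> sine_lattice p q" "\<And>x. twist ?c (int g) f x = h x"
      using twist_surj[OF c w(1) p1(1) primroot_power _ h] unfolding conj_norm_def by blast
    moreover have "\<alpha> x = 0" for x by (simp add: \<alpha>_def True)
    ultimately show ?thesis by (intro bexI[of _ f]) (simp_all add: T)
  next
    case False
    obtain v where v: "v \<in> sine_mult p q" "\<And>x. good p q x \<Longrightarrow> \<alpha> x * v x = 1"
      "\<And>x. good p q x \<Longrightarrow> conj_norm v x = 1"
      using sine_quotient_diff(2)[of "fst i" "fst j"] i j False unfolding \<alpha>_def by fastforce
    \<comment> \<open>Coefficient of the twist after division by \<alpha>, whose inverse is
      \<open>v\<close>.\<close>
    let ?d = "\<lambda>x. v x * ?c x"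
    have d: "?d \<in> sine_mult p q" by (rule sine_mult_mult[OF v(1) c])
    have "\<exists>w\<in>sine_mult p q. \<forall>x. good p q x \<longrightarrow> w x * (1 - conj_norm ?d x) = 1"
    proof (cases "snd i = snd j")
      case True
      \<comment> \<open>Here the twist is zero, so its norm is 0 and \<open>w = 1\<close> will
        do.\<close>
      then have "\<beta> = (\<lambda>x. 0)" by (simp add: \<beta>_def fun_eq_iff)
      then show ?thesis
        using sine_mult_1 by (intro bexI[of _ "\<lambda>x. 1"]) (simp_all add: conj_norm_0)
    next
      case False
      obtain w where w: "w \<in> sine_mult p q" "\<And>x. good p q x \<Longrightarrow> w x * (1 - (norm_root p q x)\<^sup>2) = 1"
        using one_minus_norm_root_square_unit by blast
      have "conj_norm ?d x = (norm_root p q x)\<^sup>2" if x: "good p q x" for x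
        by (simp add: conj_norm_mult v(3)[OF x] norm_\<beta>[OF False x] conj_norm_cos_gap[OF x])
      with w show ?thesis by auto
    qed
    then obtain w where w: "w \<in> sine_mult p q"
      "\<And>x. good p q x \<Longrightarrow> w x * (1 - conj_norm ?d x) = 1" by blast
    have vh: "(\<lambda>x. v x * h x) \<in> sine_lattice p q" by (rule sine_multD[OF v(1) h])
    obtain f where f: "f \<in> sine_lattice p q" "\<And>x. f x + twist ?d (int g) f x = v x * h x"
      using one_plus_twist_surj[OF d w(1) p1(2) primroot_power w(2)[unfolded conj_norm_def] vh]
      by blast
    \<comment> \<open>\<open>v\<close> inverts \<alpha> only at good points; elsewhere every term
      vanishes.\<close>
    have "\<alpha> x * f x + twist ?c (int g) f x = h x" for x
    proof (cases "good p q x")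
      case True
      have "\<alpha> x * f x + twist ?c (int g) f x = \<alpha> x * f x + (\<alpha> x * v x) * twist ?c (int g) f x"
        using v(2)[OF True] by simp
      also have "\<dots> = \<alpha> x * (f x + twist ?d (int g) f x)"
        by (simp add: twist_def algebra_simps)
      also have "\<dots> = (\<alpha> x * v x) * h x" by (simp add: f(2))
      finally show ?thesis using v(2)[OF True] by simp
    next
      case False
      then show ?thesis
        using sine_lattice_vanishes[OF f(1) False] sine_lattice_vanishes[OF h False]
          sine_lattice_vanishes[OF twist_in_lattice[OF c f(1)] False] by simp
    qed
    with f(1) show ?thesis by (intro bexI[of _ f]) (simp_all add: T)
  qed
qed

lemma clique_operator_sum:
  "clique_operator i (\<lambda>x. \<Sum>r<n. of_int (c r) * e r x) = (\<lambda>x. \<Sum>r<n. of_int (c r) * clique_operator i (e r) x)"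
  by (rule ext) (simp add: clique_operator_def twist_def sum_distrib_left sum.distrib ring_distribs mult_ac)

end

theorem theorem6p5:
  fixes p q :: nat
  assumes "prime p" and "prime q" and "odd p" and "odd q" and "p \<noteq> q"
    and "\<not> [int p = 1] (mod int q)" and "\<not> [int p = - 1] (mod int q)"
  shows "\<exists>C. exceptional_clique (Mat_int ((q - 1) * (p - 1) div 4)) C \<and>
             finite C \<and> card C = (p - 1)\<^sup>2"
proof -
  have p1: "p > 1" and q1: "q > 1" using assms(1,2) by (blast intro: prime_gt_1_nat)+
  obtain k where k: "p = 2 * k + 1" using \<open>odd p\<close> by (rule oddE)
  obtain m where m: "q = 2 * m + 1" using \<open>odd q\<close> by (rule oddE)
  have km: "k > 0" "m > 0" using p1 q1 k m by auto
  obtain g where g: "residue_primroot p g"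
    using prime_primitive_root_exists[of p] assms(1) p1 by auto
  \<comment> \<open>The hypotheses in the order in which the context lists them.\<close>
  note ctx = assms(1,3,2,4-7) g
  let ?J = "{1..<int p} \<times> {1..<int p}"
  have n: "(q - 1) * (p - 1) div 4 = k * m" by (simp add: k m)
  have span: "int_span (k * m) (sine_basis p q) = sine_lattice p q"
    by (rule int_span_sine_basis[OF k m km])
  have basis: "sine_basis p q r \<in> sine_lattice p q" for r
    unfolding sine_basis_def[abs_def] by (rule sine_lattice_basic)
  have "\<exists>C. exceptional_clique (Mat_int (k * m)) C \<and> finite C \<and> card C = card ?J"
  proof (rule exceptional_clique_of_operators[where T = "clique_operator p q g" and e = "sine_basis p q"])
    show "\<forall>i<k * m. c i = 0" if "\<And>x. (\<Sum>i<k * m. real_of_int (c i) * sine_basis p q i x) = 0" for c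
      by (rule sine_basis_independent[OF k m km that])
    show "clique_operator p q g j (sine_basis p q i) \<in> int_span (k * m) (sine_basis p q)"
      if "j \<in> ?J" for j i
      unfolding span by (rule clique_operator_lattice[OF ctx that basis])
    show "\<exists>f\<in>int_span (k * m) (sine_basis p q).
        \<forall>x. clique_operator p q g j f x - clique_operator p q g j' f x = sine_basis p q i x"
      if "j \<in> ?J" "j' \<in> ?J" "j \<noteq> j'" for j j' i
      unfolding span by (rule clique_operator_diff_surj[OF ctx that basis])
  qed (use km in \<open>simp_all add: clique_operator_sum[OF ctx]\<close>)
  moreover have "card ?J = (p - 1)\<^sup>2"
    using p1 by (simp add: card_cartesian_product power2_eq_square nat_diff_distrib)
  ultimately show ?thesis by (simp only: n)
qed

end
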